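(* Consider the problem $$\text{maximize } h_{\mathrm{MIN}}(x)=u_{\mathrm{MIN}}(a_1-f_1(x),\ldots,a_m-f_m(x))\ \text{ subject to } x\in K, \qquad (\mathrm{MIN}_\alpha)$$ where $u_{\mathrm{MIN}}$ is the Leontief utility function with parameters $\alpha_1,\ldots,\alpha_m\ge 0$. The following statements hold: (i) if the Slater condition is satisfied and $\widehat x\in P$ satisfies $f_j(\widehat x)\le a_j$ for all $j=1,\ldots,m$, then there exist $\alpha_j\ge 0$, $j=1,\ldots,m$, with $\alpha_{\bar\jmath}>0$ for some $\bar\jmath\in\{1,\ldots,m\}$, such that $\widehat x$ belongs to the solution set of $(\mathrm{MIN}_\alpha)$; (ii) if $\widehat x\in W$ is a Slater point (i.e. $f_j(\widehat x)<a_j$ for all $j$), then there exist $\alpha_j>0$, $j=1,\ldots,m$, such that $\widehat x$ belongs to the solution set of $(\mathrm{MIN}_\alpha)$.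
   Context: Setting: $K\subseteq\mathbb{R}^n$ is closed and convex; $f=(f_1,\ldots,f_m)^{\mathsf T}:\mathbb{R}^n\to\mathbb{R}^m$ with each $f_j$ convex; $a=(a_1,\ldots,a_m)^{\mathsf T}\in\mathbb{R}^m$; the set $\{x\in K: f_j(x)\le a_j,\ j=1,\ldots,m\}$ is nonempty and bounded. The multi-objective problem is to minimize $f(x)$ over $x\in K$. $P$ is the set of Pareto optimal points: $\widehat x\in K$ such that for every $x\in K$ either there is $j$ with $f_j(\widehat x)<f_j(x)$, or $f_j(\widehat x)\le f_j(x)$ for all $j$. $W$ is the set of weak Pareto optimal points: $\widehat x\in K$ such that for every $x\in K$ there is $j$ with $f_j(\widehat x)\le f_j(x)$. The Slater condition: there exists $\overline x\in K$ with $f_j(\overline x)<a_j$ for all $j$. Leontief utility function with parameters $\alpha_j\ge0$: $u_{\mathrm{MIN}}(y)=\min_{j=1,\ldots,m}\alpha_j y_j$ if $y\ge 0$ (componentwise), and $u_{\mathrm{MIN}}(y)=-\infty$ otherwise. A solution is a point of $K$ maximizing $h_{\mathrm{MIN}}$ over $K$. *)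

theory Defs
  imports "HOL-Analysis.Analysis"
begin

definition pareto_optimal :: "(real ^ 'n) set \<Rightarrow> (real ^ 'n \<Rightarrow> real ^ 'm) \<Rightarrow> (real ^ 'n) set" where
  "pareto_optimal K f =
     {z \<in> K. \<forall>x\<in>K. (\<exists>j. f z $ j < f x $ j) \<or> (\<forall>j. f z $ j \<le> f x $ j)}"

definition weak_pareto_optimal :: "(real ^ 'n) set \<Rightarrow> (real ^ 'n \<Rightarrow> real ^ 'm) \<Rightarrow> (real ^ 'n) set" where
  "weak_pareto_optimal K f = {z \<in> K. \<forall>x\<in>K. \<exists>j. f z $ j \<le> f x $ j}"

definition slater_condition ::
  "(real ^ 'n) set \<Rightarrow> (real ^ 'n \<Rightarrow> real ^ 'm) \<Rightarrow> real ^ 'm \<Rightarrow> bool" where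
  "slater_condition K f a \<longleftrightarrow> (\<exists>x\<in>K. \<forall>j. f x $ j < a $ j)"

definition u_MIN :: "real ^ 'm \<Rightarrow> real ^ 'm \<Rightarrow> ereal" where
  "u_MIN \<alpha> y =
     (if \<forall>j. 0 \<le> y $ j then ereal (Min (range (\<lambda>j. \<alpha> $ j * y $ j))) else -\<infinity>)"

definition h_MIN ::
  "real ^ 'm \<Rightarrow> real ^ 'm \<Rightarrow> (real ^ 'n \<Rightarrow> real ^ 'm) \<Rightarrow> real ^ 'n \<Rightarrow> ereal" where
  "h_MIN \<alpha> a f x = u_MIN \<alpha> (\<chi> j. a $ j - f x $ j)"

definition solutions_MIN ::
  "real ^ 'm \<Rightarrow> (real ^ 'n) set \<Rightarrow> real ^ 'm \<Rightarrow> (real ^ 'n \<Rightarrow> real ^ 'm) \<Rightarrow> (real ^ 'n) set" where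
  "solutions_MIN \<alpha> K a f = {z \<in> K. \<forall>x\<in>K. h_MIN \<alpha> a f x \<le> h_MIN \<alpha> a f z}"

end

theory Submission
  imports Defs
begin

text \<open>
  Both parts have the same witness: weight each objective by the reciprocal of its slack at \<open>z\<close>.
  If every slack is positive, then all weighted slacks at \<open>z\<close> equal \<open>1\<close>, and no
  competitor can push all of its own above \<open>1\<close>, since by weak Pareto optimality \<open>z\<close> is at least
  as good in some objective. If some constraint is active at \<open>z\<close>, its weight is \<open>1 / 0 = 0\<close>; the
  corresponding term then caps the minimum at \<open>0\<close> for every competitor, and \<open>z\<close> attains \<open>0\<close>
  because it is feasible. Hence every feasible weak Pareto point solves the problem with these weights
  (lemma \<open>weak_pareto_in_solutions_MIN\<close>).

  It remains to see that the weights are admissible. They are all positive when \<open>z\<close> is a Slater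
  point. In the first part, comparing the Pareto point with a Slater point shows that
  some constraint is inactive at \<open>z\<close>, so that the weights do not all vanish.
\<close>

definition reciprocal_slack ::
  "real ^ 'm \<Rightarrow> (real ^ 'n \<Rightarrow> real ^ 'm) \<Rightarrow> real ^ 'n \<Rightarrow> real ^ 'm" where
  "reciprocal_slack a f z = (\<chi> j. 1 / (a $ j - f z $ j))"

lemma reciprocal_slack_nth [simp]: "reciprocal_slack a f z $ j = 1 / (a $ j - f z $ j)"
  by (simp add: reciprocal_slack_def)

lemma pareto_optimal_subset_weak: "pareto_optimal K f \<subseteq> weak_pareto_optimal K f"
  unfolding pareto_optimal_def weak_pareto_optimal_def by (auto intro: less_imp_le)

lemma h_MIN_feasible:
  assumes "\<forall>j. f x $ j \<le> a $ j"
  shows "h_MIN \<alpha> a f x = ereal (Min (range (\<lambda>j. \<alpha> $ j * (a $ j - f x $ j))))"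
  using assms by (simp add: h_MIN_def u_MIN_def)

lemma h_MIN_infeasible:
  assumes "\<not> (\<forall>j. f x $ j \<le> a $ j)"
  shows "h_MIN \<alpha> a f x = -\<infinity>"
  using assms by (simp add: h_MIN_def u_MIN_def)

text \<open>A minimum is at most any one of its terms, so for each competitor it is enough to exhibit
  a single coordinate whose weighted slack lies below all weighted slacks at \<open>z\<close>.\<close>

lemma solutions_MIN_I:
  assumes "z \<in> K" and feas: "\<forall>j. f z $ j \<le> a $ j"
    and dom: "\<And>x. x \<in> K \<Longrightarrow> \<forall>j. f x $ j \<le> a $ j \<Longrightarrow>
      \<exists>j. \<forall>i. \<alpha> $ j * (a $ j - f x $ j) \<le> \<alpha> $ i * (a $ i - f z $ i)"
  shows "z \<in> solutions_MIN \<alpha> K a f"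
proof -
  have "h_MIN \<alpha> a f x \<le> h_MIN \<alpha> a f z" if "x \<in> K" for x
  proof (cases "\<forall>j. f x $ j \<le> a $ j")
    case True
    let ?M = "\<lambda>y. Min (range (\<lambda>i. \<alpha> $ i * (a $ i - f y $ i)))"
    obtain j where j: "\<And>i. \<alpha> $ j * (a $ j - f x $ j) \<le> \<alpha> $ i * (a $ i - f z $ i)"
      using dom[OF \<open>x \<in> K\<close> True] by blast
    have "?M x \<le> \<alpha> $ j * (a $ j - f x $ j)"
      by (rule Min_le) auto
    also have "\<dots> \<le> ?M z"
      using j by (intro Min.boundedI) auto
    finally have "?M x \<le> ?M z" .
    then show ?thesis
      using True feas by (simp add: h_MIN_feasible)
  qed (simp add: h_MIN_infeasible)
  with \<open>z \<in> K\<close> show ?thesis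
    by (simp add: solutions_MIN_def)
qed

text \<open>The coordinate needed by \<open>solutions_MIN_I\<close> is an active constraint of \<open>z\<close>, where the weight
  is zero, or else one in which weak Pareto optimality favours \<open>z\<close>.\<close>

lemma weak_pareto_in_solutions_MIN:
  assumes weak: "z \<in> weak_pareto_optimal K f" and feas: "\<forall>j. f z $ j \<le> a $ j"
  shows "z \<in> solutions_MIN (reciprocal_slack a f z) K a f" (is "_ \<in> solutions_MIN ?\<alpha> _ _ _")
proof (rule solutions_MIN_I[where f = f and z = z, OF _ feas])
  show "z \<in> K"
    using weak by (simp add: weak_pareto_optimal_def)
next
  fix x assume "x \<in> K"
  show "\<exists>j. \<forall>i. ?\<alpha> $ j * (a $ j - f x $ j) \<le> ?\<alpha> $ i * (a $ i - f z $ i)"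
  proof (cases "\<exists>k. f z $ k = a $ k")
    case True
    then obtain k where "f z $ k = a $ k" ..
    \<comment> \<open>Division by zero makes the left-hand side vanish.\<close>
    then have "?\<alpha> $ k * (a $ k - f x $ k) \<le> ?\<alpha> $ i * (a $ i - f z $ i)" for i
      using feas by simp
    then show ?thesis by blast
  next
    case False
    with feas have slack: "0 < a $ i - f z $ i" for i
      by (metis diff_gt_0_iff_gt order_le_less)
    obtain j where "f z $ j \<le> f x $ j"
      using weak \<open>x \<in> K\<close> by (auto simp: weak_pareto_optimal_def)
    then have "?\<alpha> $ j * (a $ j - f x $ j) \<le> 1"
      using slack[of j] by simp
    moreover have "?\<alpha> $ i * (a $ i - f z $ i) = 1" for i
      using slack[of i] by simp
    ultimately show ?thesis by metis
  qed
qed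

text \<open>Some objective at \<open>z\<close> is bounded by its value at the Slater point, because no point of \<open>K\<close>
  improves on \<open>z\<close> in all objectives, and that value lies strictly below its bound in \<open>a\<close>.\<close>

lemma pareto_inactive_constraint:
  assumes "slater_condition K f a" and "z \<in> pareto_optimal K f"
  shows "\<exists>j. f z $ j < a $ j"
proof -
  obtain s where s: "s \<in> K" "\<forall>j. f s $ j < a $ j"
    using assms(1) by (auto simp: slater_condition_def)
  obtain j where "f z $ j \<le> f s $ j"
    using subsetD[OF pareto_optimal_subset_weak assms(2)] s(1)
    by (auto simp: weak_pareto_optimal_def)
  then show ?thesis
    using s(2) by (meson le_less_trans)
qed

theorem theorem3p13:
  fixes K :: "(real ^ 'n) set"
    and f :: "real ^ 'n \<Rightarrow> real ^ 'm"
    and a :: "real ^ 'm"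
  assumes "closed K" and "convex K"
    and "\<And>j. convex_on UNIV (\<lambda>x. f x $ j)"
    and "{x \<in> K. \<forall>j. f x $ j \<le> a $ j} \<noteq> {}"
    and "bounded {x \<in> K. \<forall>j. f x $ j \<le> a $ j}"
  shows "(\<forall>z. slater_condition K f a \<and> z \<in> pareto_optimal K f \<and> (\<forall>j. f z $ j \<le> a $ j) \<longrightarrow>
            (\<exists>\<alpha> :: real ^ 'm. (\<forall>j. 0 \<le> \<alpha> $ j) \<and> (\<exists>i. 0 < \<alpha> $ i) \<and> z \<in> solutions_MIN \<alpha> K a f))
       \<and> (\<forall>z. z \<in> weak_pareto_optimal K f \<and> (\<forall>j. f z $ j < a $ j) \<longrightarrow>
            (\<exists>\<alpha> :: real ^ 'm. (\<forall>j. 0 < \<alpha> $ j) \<and> z \<in> solutions_MIN \<alpha> K a f))"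
proof (intro conjI allI impI; elim conjE)
  fix z
  assume slater: "slater_condition K f a" and pareto: "z \<in> pareto_optimal K f"
    and feas: "\<forall>j. f z $ j \<le> a $ j"
  let ?\<alpha> = "reciprocal_slack a f z"
  have "\<forall>j. 0 \<le> ?\<alpha> $ j"
    using feas by simp
  moreover have "\<exists>i. 0 < ?\<alpha> $ i"
    using pareto_inactive_constraint[OF slater pareto] by simp
  moreover have "z \<in> solutions_MIN ?\<alpha> K a f"
    using pareto feas pareto_optimal_subset_weak by (blast intro: weak_pareto_in_solutions_MIN)
  ultimately show "\<exists>\<alpha>. (\<forall>j. 0 \<le> \<alpha> $ j) \<and> (\<exists>i. 0 < \<alpha> $ i) \<and> z \<in> solutions_MIN \<alpha> K a f"
    by blast
next
  fix z
  assume weak: "z \<in> weak_pareto_optimal K f" and strict: "\<forall>j. f z $ j < a $ j"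
  let ?\<alpha> = "reciprocal_slack a f z"
  have "\<forall>j. 0 < ?\<alpha> $ j"
    using strict by simp
  moreover have "z \<in> solutions_MIN ?\<alpha> K a f"
    using weak strict by (intro weak_pareto_in_solutions_MIN) (auto intro: less_imp_le)
  ultimately show "\<exists>\<alpha>. (\<forall>j. 0 < \<alpha> $ j) \<and> z \<in> solutions_MIN \<alpha> K a f"
    by blast
qed

end
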